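(* Let $q$ be a prime power and $k>1$ an integer. Let $\Pi = PG(2,q^k)$, let $\pi = PG(2,q)$ be a subplane of $\Pi$, choose a point $D$ of $\pi$, let $\mathcal{S}$ be the set of lines $\overline{Dp}$ of $\Pi$ with $p$ a point of $\pi$ other than $D$, let $\mathcal{P}=\bigcup\mathcal{S}$, and let $\mathcal{O}$ be the set of restrictions $L\cap\mathcal{P}$ of the lines $L$ of $\Pi$ not containing $D$. Then the incidence structure $R(q,q^k)$ with point set $\mathcal{P}$ and line set $\mathcal{S}\cup\mathcal{O}$ (incidence being membership) is a projective rectangle with special point $D$.
   Context: A projective rectangle is an incidence structure satisfying: (A1) every two distinct points are incident with exactly one line; (A2) there exist four points no three of which are collinear; (A3) every line is incident with at least three distinct points; (A4) there is a distinguished point $D$, the special point; lines incident with $D$ are called special, lines not incident with $D$ are called ordinary; (A5) each special line intersects every other line in exactly one point; (A6) if two ordinary lines $l_1,l_2$ intersect in a point, then every two lines that intersect both $l_1$ and $l_2$ in four distinct points intersect in a point. *)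

theory Defs
  imports "HOL-Analysis.Analysis" "HOL-Number_Theory.Prime_Powers"
begin

record ('p, 'l) incidence_structure =
  Points :: "'p set"
  Lines :: "'l set"
  Inc :: "'p \<Rightarrow> 'l \<Rightarrow> bool"

definition meet_in_point :: "('p, 'l) incidence_structure \<Rightarrow> 'l \<Rightarrow> 'l \<Rightarrow> bool" where
  "meet_in_point R l m \<longleftrightarrow> (\<exists>p\<in>Points R. Inc R p l \<and> Inc R p m)"

definition collinear_in :: "('p, 'l) incidence_structure \<Rightarrow> 'p set \<Rightarrow> bool" where
  "collinear_in R A \<longleftrightarrow> (\<exists>l\<in>Lines R. \<forall>p\<in>A. Inc R p l)"

definition has_unique_joins :: "('p, 'l) incidence_structure \<Rightarrow> bool" where
  "has_unique_joins R \<longleftrightarrow>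
     (\<forall>p\<in>Points R. \<forall>p'\<in>Points R. p \<noteq> p' \<longrightarrow> (\<exists>!l. l \<in> Lines R \<and> Inc R p l \<and> Inc R p' l))"

definition has_quadrangle :: "('p, 'l) incidence_structure \<Rightarrow> bool" where
  "has_quadrangle R \<longleftrightarrow>
     (\<exists>Q \<subseteq> Points R. card Q = 4 \<and> (\<forall>T \<subseteq> Q. card T = 3 \<longrightarrow> \<not> collinear_in R T))"

definition projective_plane :: "('p, 'l) incidence_structure \<Rightarrow> bool" where
  "projective_plane R \<longleftrightarrow>
     has_unique_joins R \<and>
     (\<forall>l\<in>Lines R. \<forall>m\<in>Lines R. l \<noteq> m \<longrightarrow> (\<exists>!p. p \<in> Points R \<and> Inc R p l \<and> Inc R p m)) \<and>
     has_quadrangle R"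

text \<open>
  A line of a subplane is identified with the line of the ambient plane that carries it, so when
  lines are point sets, a line of the subplane may contain points outside the subplane.
\<close>

definition subplane :: "('p, 'l) incidence_structure \<Rightarrow> ('p, 'l) incidence_structure \<Rightarrow> bool" where
  "subplane S R \<longleftrightarrow>
     projective_plane S \<and> Points S \<subseteq> Points R \<and> Lines S \<subseteq> Lines R \<and>
     (\<forall>p\<in>Points S. \<forall>l\<in>Lines S. Inc S p l \<longleftrightarrow> Inc R p l)"

definition isomorphic_incidence ::
    "('p, 'l) incidence_structure \<Rightarrow> ('p', 'l') incidence_structure \<Rightarrow> bool" where
  "isomorphic_incidence R S \<longleftrightarrow>
     (\<exists>f g. bij_betw f (Points R) (Points S) \<and> bij_betw g (Lines R) (Lines S) \<and>
        (\<forall>p\<in>Points R. \<forall>l\<in>Lines R. Inc R p l \<longleftrightarrow> Inc S (f p) (g l)))"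

text \<open>
  The plane over the field \<open>'a\<close>: points are the one-dimensional subspaces of \<open>'a ^ 3\<close>, and a line
  is the set of all points lying in a given two-dimensional subspace.
\<close>

definition PG2_points :: "('a::field ^ 3) set set" where
  "PG2_points = {U. vec.subspace U \<and> vec.dim U = 1}"

definition PG2 :: "(('a::field ^ 3) set, ('a ^ 3) set set) incidence_structure" where
  "PG2 = \<lparr>Points = PG2_points,
          Lines = {{U \<in> PG2_points. U \<subseteq> W} | W. vec.subspace W \<and> vec.dim W = 2},
          Inc = (\<in>)\<rparr>"

definition projective_rectangle :: "('p, 'l) incidence_structure \<Rightarrow> 'p \<Rightarrow> bool" where
  "projective_rectangle R D \<longleftrightarrow>
     has_unique_joins R \<and>
     has_quadrangle R \<and>
     (\<forall>l\<in>Lines R. \<exists>A \<subseteq> Points R. card A = 3 \<and> (\<forall>p\<in>A. Inc R p l)) \<and>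
     D \<in> Points R \<and>
     (\<forall>s\<in>Lines R. \<forall>l\<in>Lines R. Inc R D s \<and> l \<noteq> s \<longrightarrow>
        (\<exists>!p. p \<in> Points R \<and> Inc R p s \<and> Inc R p l)) \<and>
     (\<forall>l1\<in>Lines R. \<forall>l2\<in>Lines R.
        \<not> Inc R D l1 \<and> \<not> Inc R D l2 \<and> l1 \<noteq> l2 \<and> meet_in_point R l1 l2 \<longrightarrow>
        (\<forall>m1\<in>Lines R. \<forall>m2\<in>Lines R. m1 \<noteq> m2 \<and>
           (\<exists>p11\<in>Points R. \<exists>p12\<in>Points R. \<exists>p21\<in>Points R. \<exists>p22\<in>Points R.
              distinct [p11, p12, p21, p22] \<and>
              Inc R p11 m1 \<and> Inc R p11 l1 \<and> Inc R p12 m1 \<and> Inc R p12 l2 \<and>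
              Inc R p21 m2 \<and> Inc R p21 l1 \<and> Inc R p22 m2 \<and> Inc R p22 l2) \<longrightarrow>
           meet_in_point R m1 m2))"

text \<open>
  In the following three definitions \<open>Pl\<close> is the ambient plane, its lines are point sets with
  membership as incidence, and \<open>S\<close> is the subplane.
\<close>

definition rect_special_lines ::
    "('p, 'p set) incidence_structure \<Rightarrow> ('p, 'p set) incidence_structure \<Rightarrow> 'p \<Rightarrow> 'p set set" where
  "rect_special_lines Pl S D = {L \<in> Lines Pl. \<exists>p\<in>Points S. p \<noteq> D \<and> D \<in> L \<and> p \<in> L}"

definition rect_ordinary_lines ::
    "('p, 'p set) incidence_structure \<Rightarrow> ('p, 'p set) incidence_structure \<Rightarrow> 'p \<Rightarrow> 'p set set" where
  "rect_ordinary_lines Pl S D = {L \<inter> \<Union>(rect_special_lines Pl S D) | L. L \<in> Lines Pl \<and> D \<notin> L}"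

definition subplane_rectangle ::
    "('p, 'p set) incidence_structure \<Rightarrow> ('p, 'p set) incidence_structure \<Rightarrow> 'p \<Rightarrow>
     ('p, 'p set) incidence_structure" where
  "subplane_rectangle Pl S D =
     \<lparr>Points = \<Union>(rect_special_lines Pl S D),
      Lines = rect_special_lines Pl S D \<union> rect_ordinary_lines Pl S D,
      Inc = (\<in>)\<rparr>"

end

theory Submission
  imports Defs
begin

text \<open>
  All axioms but (A6) follow from the fact that the special lines are exactly the lines of the
  subplane through \<open>D\<close>. For (A6), fix a vector \<open>d\<close> spanning \<open>D\<close> and describe each line of the big
  plane not through \<open>D\<close> by the unique linear functional that vanishes on it and takes the value 1 at
  \<open>d\<close>. These functionals form an affine plane in which the difference of two of them, up to scaling,
  is the line joining \<open>D\<close> to the point of intersection. Given a complete quadrilateral of ordinary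
  lines with five vertices on special lines, build a quadrilateral inside the subplane whose five
  corresponding vertices lie on the same special lines. In the affine plane of functionals
  corresponding sides of two triangles are parallel, so the two quadrilaterals are homothetic and the
  sixth differences are parallel too: the sixth vertices lie on a common line through \<open>D\<close>, and it is
  special because it contains a vertex in the subplane.
\<close>

section \<open>Dot and cross products over a field\<close>

definition dot3 :: "'a::field ^ 3 \<Rightarrow> 'a ^ 3 \<Rightarrow> 'a" where
  "dot3 x y = x $ 1 * y $ 1 + x $ 2 * y $ 2 + x $ 3 * y $ 3"

definition cross :: "'a::field ^ 3 \<Rightarrow> 'a ^ 3 \<Rightarrow> 'a ^ 3" where
  "cross x y = vector [x $ 2 * y $ 3 - x $ 3 * y $ 2,
                       x $ 3 * y $ 1 - x $ 1 * y $ 3,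
                       x $ 1 * y $ 2 - x $ 2 * y $ 1]"

text \<open>The line with homogeneous line coordinates \<open>c\<close>, that is, the kernel of the
  functional \<open>dot3 c\<close>. It is a line of the plane only for nonzero \<open>c\<close>; for
  \<open>c = 0\<close> it consists of all points.\<close>

definition pg_line :: "'a::field ^ 3 \<Rightarrow> ('a ^ 3) set set" where
  "pg_line c = {vec.span {x} | x. x \<noteq> 0 \<and> dot3 c x = 0}"

lemma cross_nth [simp]:
  "cross x y $ 1 = x $ 2 * y $ 3 - x $ 3 * y $ 2"
  "cross x y $ 2 = x $ 3 * y $ 1 - x $ 1 * y $ 3"
  "cross x y $ 3 = x $ 1 * y $ 2 - x $ 2 * y $ 1"
  by (simp_all add: cross_def)

lemma vec3_eq_iff: "x = y \<longleftrightarrow> x $ 1 = y $ 1 \<and> x $ 2 = y $ 2 \<and> x $ 3 = y $ 3"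
  for x y :: "'a ^ 3"
  by (simp add: vec_eq_iff forall_3)

lemma dot3_commute: "dot3 x y = dot3 y x"
  by (simp add: dot3_def mult.commute)

lemma dot3_scale_left [simp]: "dot3 (k *s x) y = k * dot3 x y"
  by (simp add: dot3_def algebra_simps)

lemma dot3_scale_right [simp]: "dot3 x (k *s y) = k * dot3 x y"
  by (simp add: dot3_def algebra_simps)

lemma dot3_add_right [simp]: "dot3 x (y + z) = dot3 x y + dot3 x z"
  by (simp add: dot3_def algebra_simps)

lemma dot3_diff_left [simp]: "dot3 (x - y) z = dot3 x z - dot3 y z"
  by (simp add: dot3_def algebra_simps)

lemma dot3_zero [simp]: "dot3 0 x = 0" "dot3 x 0 = 0"
  by (simp_all add: dot3_def)

lemma dot3_cross [simp]:
  "dot3 (cross x y) x = 0" "dot3 (cross x y) y = 0"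
  by (simp_all add: dot3_def algebra_simps)

lemma cross_scale_right: "cross x (k *s y) = k *s cross x y"
  by (simp add: vec3_eq_iff algebra_simps)

lemma cross_zero [simp]: "cross 0 x = 0" "cross x 0 = 0"
  by (simp_all add: vec3_eq_iff)

lemma cross_self [simp]: "cross x x = 0"
  by (simp add: vec3_eq_iff)

text \<open>Vanishing of the cross product says that all 2 by 2 minors of the pair vanish, so the
  ratio at one nonzero coordinate of \<open>x\<close> is the ratio at every coordinate.\<close>

lemma cross_eq_0_imp_scale:
  assumes "cross x y = 0" "x \<noteq> 0"
  shows "\<exists>k. y = k *s x"
proof -
  have eqs: "x $ 2 * y $ 3 = x $ 3 * y $ 2" "x $ 3 * y $ 1 = x $ 1 * y $ 3"
    "x $ 1 * y $ 2 = x $ 2 * y $ 1"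
    using assms(1) by (simp_all add: vec3_eq_iff)
  from assms(2) consider "x $ 1 \<noteq> 0" | "x $ 2 \<noteq> 0" | "x $ 3 \<noteq> 0"
    by (auto simp: vec3_eq_iff)
  then show ?thesis
  proof cases
    case 1
    then show ?thesis using eqs
      by (intro exI[of _ "y $ 1 / x $ 1"]) (simp add: vec3_eq_iff field_simps)
  next
    case 2
    then show ?thesis using eqs
      by (intro exI[of _ "y $ 2 / x $ 2"]) (simp add: vec3_eq_iff field_simps)
  next
    case 3
    then show ?thesis using eqs
      by (intro exI[of _ "y $ 3 / x $ 3"]) (simp add: vec3_eq_iff field_simps)
  qed
qed

lemma cross_cross: "cross e (cross x y) = dot3 e y *s x - dot3 e x *s y"
  by (simp add: vec3_eq_iff dot3_def algebra_simps)

text \<open>The triple product expansion \<open>cross_cross\<close> makes the cross product of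
  \<open>e\<close> and \<open>cross x y\<close> vanish, and two vectors with vanishing cross product
  are proportional.\<close>

lemma orthogonal_imp_scale_cross:
  assumes "cross x y \<noteq> 0" "dot3 e x = 0" "dot3 e y = 0"
  shows "\<exists>k. e = k *s cross x y"
proof (rule cross_eq_0_imp_scale)
  have "cross (cross x y) e = - cross e (cross x y)"
    by (simp only: vec3_eq_iff cross_nth vector_uminus_component) (simp add: algebra_simps)
  then show "cross (cross x y) e = 0"
    using assms by (simp add: cross_cross)
qed (fact assms(1))

text \<open>The functionals vanishing on two independent vectors form a one-dimensional space. This
  is the source of all proportionalities between functionals below.\<close>

lemma common_orthogonal_scale:
  assumes "cross x y \<noteq> 0" "dot3 c x = 0" "dot3 c y = 0" "dot3 e x = 0" "dot3 e y = 0" "c \<noteq> 0"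
  shows "\<exists>k. e = k *s c"
proof -
  obtain k l where k: "c = k *s cross x y" and l: "e = l *s cross x y"
    using assms orthogonal_imp_scale_cross by metis
  with \<open>c \<noteq> 0\<close> have "k \<noteq> 0" by auto
  then have "e = (l / k) *s c" by (simp add: k l)
  then show ?thesis ..
qed

text \<open>A nonzero coordinate of \<open>c\<close> yields two evident solutions of
  \<open>dot3 c x = 0\<close>, and their cross product is that coordinate times \<open>c\<close>.
  The factor \<open>k\<close> is harmless because coordinates matter only up to scaling.\<close>

lemma cross_surj:
  assumes "c \<noteq> 0"
  shows "\<exists>u v k. k \<noteq> 0 \<and> cross u v = k *s c"
proof -
  from assms consider "c $ 1 \<noteq> 0" | "c $ 2 \<noteq> 0" | "c $ 3 \<noteq> 0"
    by (auto simp: vec3_eq_iff)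
  then show ?thesis
  proof cases
    case 1
    then show ?thesis
      by (intro exI[of _ "vector [- c $ 2, c $ 1, 0]"] exI[of _ "vector [- c $ 3, 0, c $ 1]"]
          exI[of _ "c $ 1"]) (simp add: vec3_eq_iff)
  next
    case 2
    then show ?thesis
      by (intro exI[of _ "vector [0, - c $ 3, c $ 2]"] exI[of _ "vector [c $ 2, - c $ 1, 0]"]
          exI[of _ "c $ 2"]) (simp add: vec3_eq_iff)
  next
    case 3
    then show ?thesis
      by (intro exI[of _ "vector [c $ 3, 0, - c $ 1]"] exI[of _ "vector [0, c $ 3, - c $ 2]"]
          exI[of _ "c $ 3"]) (simp add: vec3_eq_iff)
  qed
qed

lemma cross_orthogonal_basis:
  assumes "c \<noteq> 0"
  obtains u v where "cross u v \<noteq> 0" "dot3 c u = 0" "dot3 c v = 0"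
proof -
  obtain u v k where k: "k \<noteq> 0" "cross u v = k *s c"
    using cross_surj[OF assms] by blast
  have "k * dot3 c u = 0" "k * dot3 c v = 0"
    using dot3_cross[of u v] unfolding k(2) by simp_all
  with k assms show thesis by (intro that[of u v]) auto
qed

section \<open>Two-dimensional subspaces as kernels of functionals\<close>

lemma independent_pair_iff_cross:
  fixes u v :: "'a::field ^ 3"
  shows "u \<noteq> v \<and> vec.independent {u, v} \<longleftrightarrow> cross u v \<noteq> 0"
proof
  assume L: "u \<noteq> v \<and> vec.independent {u, v}"
  show "cross u v \<noteq> 0"
  proof
    assume "cross u v = 0"
    moreover have "u \<noteq> 0" using L vec.dependent_zero by blast
    ultimately obtain k where "v = k *s u" using cross_eq_0_imp_scale by blast
    then have "v \<in> vec.span {u}" by (auto simp: vec.span_singleton)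
    with L show False by (auto simp: insert_commute[of u v] vec.independent_insert split: if_splits)
  qed
next
  assume R: "cross u v \<noteq> 0"
  then have "u \<noteq> v" "u \<noteq> 0" by auto
  moreover have "v \<notin> vec.span {u}"
    using R by (auto simp: vec.span_singleton cross_scale_right)
  ultimately show "u \<noteq> v \<and> vec.independent {u, v}"
    by (simp add: insert_commute[of u v] vec.independent_insert)
qed

lemma span_pair_eq_orthogonal:
  fixes u v :: "'a::field ^ 3"
  assumes "cross u v \<noteq> 0"
  shows "vec.span {u, v} = {x. dot3 (cross u v) x = 0}"
proof (intro set_eqI iffI)
  fix x assume "x \<in> vec.span {u, v}"
  then obtain k l where "x = k *s u + l *s v"
    by (auto simp: vec.span_insert vec.span_singleton) (metis add.commute diff_add_cancel)
  then show "x \<in> {x. dot3 (cross u v) x = 0}" by simp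
next
  fix x assume "x \<in> {x. dot3 (cross u v) x = 0}"
  then have x: "dot3 (cross u v) x = 0" by simp
  \<comment> \<open>Some axis vector \<open>e\<close> completes \<open>u\<close>, \<open>v\<close>
    to a basis.\<close>
  obtain e where e: "dot3 e (cross u v) \<noteq> 0"
  proof -
    from assms consider "cross u v $ 1 \<noteq> 0" | "cross u v $ 2 \<noteq> 0" | "cross u v $ 3 \<noteq> 0"
      by (auto simp only: vec3_eq_iff zero_index)
    then show thesis
      by cases (use that[of "axis 1 1"] that[of "axis 2 1"] that[of "axis 3 1"] in
          \<open>auto simp: dot3_def axis_def\<close>)
  qed
  \<comment> \<open>Cramer's rule for the coordinates of \<open>x\<close> in the basis
    \<open>u\<close>, \<open>v\<close>, \<open>e\<close>. The coordinate along \<open>e\<close>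
    vanishes by the assumption on \<open>x\<close>.\<close>
  have "dot3 e (cross u v) *s x
      = dot3 e (cross x v) *s u + dot3 e (cross u x) *s v + dot3 (cross u v) x *s e"
    by (simp add: vec3_eq_iff dot3_def algebra_simps)
  then have "x = (dot3 e (cross x v) / dot3 e (cross u v)) *s u
      + (dot3 e (cross u x) / dot3 e (cross u v)) *s v"
    using e x by (simp add: vec3_eq_iff field_simps)
  then show "x \<in> vec.span {u, v}"
    by (metis insertI1 insertI2 vec.span_add vec.span_base vec.span_scale)
qed

text \<open>In one direction \<open>c\<close> is the cross product of a basis of \<open>W\<close>;
  in the other, \<open>cross_surj\<close> recovers a basis from \<open>c\<close>.\<close>

lemma two_dim_subspace_iff:
  fixes W :: "('a::field ^ 3) set"
  shows "vec.subspace W \<and> vec.dim W = 2 \<longleftrightarrow> (\<exists>c. c \<noteq> 0 \<and> W = {x. dot3 c x = 0})"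
proof
  assume W: "vec.subspace W \<and> vec.dim W = 2"
  obtain B where B: "B \<subseteq> W" "vec.independent B" "W \<subseteq> vec.span B" "card B = vec.dim W"
    using vec.basis_exists by blast
  then obtain u v where uv: "B = {u, v}" "u \<noteq> v"
    using W by (metis card_2_iff)
  have "W = vec.span {u, v}"
    using B W uv vec.span_minimal by blast
  moreover have "cross u v \<noteq> 0"
    using B uv independent_pair_iff_cross by blast
  ultimately show "\<exists>c. c \<noteq> 0 \<and> W = {x. dot3 c x = 0}"
    using span_pair_eq_orthogonal by blast
next
  assume "\<exists>c. c \<noteq> 0 \<and> W = {x. dot3 c x = 0}"
  then obtain c where c: "c \<noteq> 0" and W: "W = {x. dot3 c x = 0}" by blast
  obtain u v k where k: "k \<noteq> 0" "cross u v = k *s c"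
    using cross_surj[OF c] by blast
  then have nz: "cross u v \<noteq> 0" using c by simp
  have W': "W = vec.span {u, v}"
    using k by (simp add: W span_pair_eq_orthogonal[OF nz])
  have "u \<noteq> v" "vec.independent {u, v}"
    using nz independent_pair_iff_cross by blast+
  then show "vec.subspace W \<and> vec.dim W = 2"
    by (simp add: W' vec.dim_span vec.dim_eq_card_independent)
qed

section \<open>The projective plane in homogeneous coordinates\<close>

lemma PG2_points_eq: "PG2_points = {vec.span {x} | x :: 'a::field ^ 3. x \<noteq> 0}"
proof (intro set_eqI iffI)
  fix U :: "('a ^ 3) set" assume "U \<in> PG2_points"
  then have U: "vec.subspace U" "vec.dim U = 1" by (auto simp: PG2_points_def)
  obtain B where B: "B \<subseteq> U" "vec.independent B" "U \<subseteq> vec.span B" "card B = vec.dim U"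
    using vec.basis_exists by blast
  then obtain x where x: "B = {x}" using U by (metis card_1_singletonE)
  have "U = vec.span {x}" using B U x vec.span_minimal by blast
  moreover have "x \<noteq> 0" using B x by auto
  ultimately show "U \<in> {vec.span {x} | x. x \<noteq> 0}" by blast
next
  fix U :: "('a ^ 3) set" assume "U \<in> {vec.span {x} | x. x \<noteq> 0}"
  then obtain x where "U = vec.span {x}" "x \<noteq> 0" by blast
  then show "U \<in> PG2_points"
    by (simp add: PG2_points_def vec.dim_span vec.dim_eq_card_independent)
qed

lemma Points_PG2: "Points PG2 = {vec.span {x} | x. x \<noteq> 0}"
  by (simp add: PG2_def PG2_points_eq)

lemma Inc_PG2 [simp]: "Inc PG2 = (\<in>)"
  by (simp add: PG2_def)

lemma Lines_PG2: "Lines PG2 = {pg_line c | c :: 'a::field ^ 3. c \<noteq> 0}"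
proof -
  have *: "{U \<in> PG2_points. U \<subseteq> {x. dot3 c x = 0}} = pg_line c" for c :: "'a ^ 3"
  proof -
    have "vec.span {x} \<subseteq> {x. dot3 c x = 0} \<longleftrightarrow> dot3 c x = 0" for x
    proof
      assume "vec.span {x} \<subseteq> {x. dot3 c x = 0}"
      moreover have "x \<in> vec.span {x}" by (simp add: vec.span_base)
      ultimately show "dot3 c x = 0" by blast
    qed (auto simp: vec.span_singleton)
    then show ?thesis by (auto simp: PG2_points_eq pg_line_def)
  qed
  have "Lines PG2 = {{U \<in> PG2_points. U \<subseteq> W} | W :: ('a ^ 3) set.
      \<exists>c. c \<noteq> 0 \<and> W = {x. dot3 c x = 0}}"
    by (simp add: PG2_def two_dim_subspace_iff)
  also have "\<dots> = {{U \<in> PG2_points. U \<subseteq> {x. dot3 c x = 0}} | c :: 'a ^ 3. c \<noteq> 0}"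
    by blast
  finally show ?thesis by (simp only: *)
qed

lemma span_eq_iff_cross:
  fixes x y :: "'a::field ^ 3"
  assumes "x \<noteq> 0" "y \<noteq> 0"
  shows "vec.span {x} = vec.span {y} \<longleftrightarrow> cross x y = 0"
proof
  assume "vec.span {x} = vec.span {y}"
  then have "y \<in> vec.span {x}" by (simp add: vec.span_base)
  then show "cross x y = 0" by (auto simp: vec.span_singleton cross_scale_right)
next
  assume "cross x y = 0"
  then obtain k where k: "y = k *s x" using cross_eq_0_imp_scale assms by blast
  then have "k \<noteq> 0" using assms by auto
  then have "x = (1 / k) *s y" by (simp add: k)
  then have "x \<in> vec.span {y}" "y \<in> vec.span {x}"
    using k by (metis singletonI vec.span_base vec.span_scale)+
  then show "vec.span {x} = vec.span {y}"
    by (simp add: vec.span_eq)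
qed

lemma span_in_pg_line_iff:
  assumes "x \<noteq> 0"
  shows "vec.span {x} \<in> pg_line c \<longleftrightarrow> dot3 c x = 0"
proof
  assume "vec.span {x} \<in> pg_line c"
  then obtain y where y: "vec.span {x} = vec.span {y}" "dot3 c y = 0"
    by (auto simp: pg_line_def)
  then have "x \<in> vec.span {y}" by (metis insertI1 vec.span_base)
  then show "dot3 c x = 0" using y by (auto simp: vec.span_singleton)
qed (use assms in \<open>auto simp: pg_line_def\<close>)

lemma pg_line_scale: "k \<noteq> 0 \<Longrightarrow> pg_line (k *s c) = pg_line c"
  by (simp add: pg_line_def)

text \<open>Dual to \<open>span_eq_iff_cross\<close>: a line carries two independent vectors, and
  these fix its coordinate vector up to scaling.\<close>

lemma pg_line_eq_iff_cross:
  assumes "c \<noteq> 0" "e \<noteq> 0"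
  shows "pg_line c = pg_line e \<longleftrightarrow> cross c e = 0"
proof
  assume eq: "pg_line c = pg_line e"
  obtain u v where uv: "cross u v \<noteq> 0" "dot3 c u = 0" "dot3 c v = 0"
    using cross_orthogonal_basis[OF assms(1)] by blast
  then have "u \<noteq> 0" "v \<noteq> 0" by auto
  then have "dot3 e u = 0" "dot3 e v = 0"
    using uv eq by (metis span_in_pg_line_iff)+
  then obtain k where "e = k *s c"
    using common_orthogonal_scale uv assms by metis
  then show "cross c e = 0" by (simp add: cross_scale_right)
next
  assume "cross c e = 0"
  then obtain k where k: "e = k *s c" using cross_eq_0_imp_scale assms by blast
  then have "k \<noteq> 0" using assms by auto
  then show "pg_line c = pg_line e" by (simp add: k pg_line_scale)
qed

lemma PG2_line_subset: "L \<in> Lines PG2 \<Longrightarrow> L \<subseteq> Points PG2"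
  by (auto simp: Lines_PG2 Points_PG2 pg_line_def)

text \<open>The cross product of the coordinates of two points gives the coordinates of their join;
  dually, \<open>PG2_meet\<close> obtains a common point of two lines in the same way.\<close>

lemma PG2_join:
  assumes "p \<in> Points PG2" "p' \<in> Points PG2" "p \<noteq> p'"
  shows "\<exists>L\<in>Lines PG2. p \<in> L \<and> p' \<in> L"
proof -
  obtain x y where xy: "x \<noteq> 0" "y \<noteq> 0" "p = vec.span {x}" "p' = vec.span {y}"
    using assms by (auto simp: Points_PG2)
  then have "cross x y \<noteq> 0" using assms span_eq_iff_cross by blast
  then have "pg_line (cross x y) \<in> Lines PG2" by (auto simp: Lines_PG2)
  moreover have "p \<in> pg_line (cross x y)" "p' \<in> pg_line (cross x y)"
    using xy by (simp_all add: span_in_pg_line_iff)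
  ultimately show ?thesis by blast
qed

lemma PG2_join_unique:
  assumes "L \<in> Lines PG2" "M \<in> Lines PG2" "p \<in> L" "p' \<in> L" "p \<in> M" "p' \<in> M" "p \<noteq> p'"
  shows "L = M"
proof -
  obtain c e where ce: "c \<noteq> 0" "e \<noteq> 0" "L = pg_line c" "M = pg_line e"
    using assms by (auto simp: Lines_PG2)
  obtain x y where xy: "x \<noteq> 0" "y \<noteq> 0" "p = vec.span {x}" "p' = vec.span {y}"
    using assms ce unfolding pg_line_def by blast
  have d: "dot3 c x = 0" "dot3 c y = 0" "dot3 e x = 0" "dot3 e y = 0"
    using assms xy ce by (simp_all add: span_in_pg_line_iff)
  have "cross x y \<noteq> 0" using assms xy span_eq_iff_cross by blast
  then obtain k where "e = k *s c" using common_orthogonal_scale ce d by metis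
  then show ?thesis using ce by (simp add: pg_line_eq_iff_cross cross_scale_right)
qed

lemma PG2_meet:
  assumes "L \<in> Lines PG2" "M \<in> Lines PG2" "L \<noteq> M"
  shows "\<exists>p. p \<in> L \<and> p \<in> M"
proof -
  obtain c e where ce: "c \<noteq> 0" "e \<noteq> 0" "L = pg_line c" "M = pg_line e"
    using assms by (auto simp: Lines_PG2)
  then have nz: "cross c e \<noteq> 0" using assms pg_line_eq_iff_cross by blast
  have "dot3 c (cross c e) = 0" "dot3 e (cross c e) = 0"
    by (metis dot3_commute dot3_cross)+
  then have "vec.span {cross c e} \<in> L \<and> vec.span {cross c e} \<in> M"
    using ce nz by (simp add: span_in_pg_line_iff)
  then show ?thesis ..
qed

text \<open>The vectors \<open>u\<close>, \<open>v\<close> and \<open>u + v\<close> are pairwise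
  independent over every field, including the one with two elements. The result serves both for
  points on a line and for lines through a point.\<close>

lemma orthogonal_three:
  assumes "c \<noteq> 0"
  obtains u v w where "u \<noteq> 0" "v \<noteq> 0" "w \<noteq> 0" "dot3 c u = 0" "dot3 c v = 0" "dot3 c w = 0"
    "cross u v \<noteq> 0" "cross u w \<noteq> 0" "cross v w \<noteq> 0"
proof -
  obtain u v where uv: "cross u v \<noteq> 0" "dot3 c u = 0" "dot3 c v = 0"
    using cross_orthogonal_basis[OF assms] by blast
  have "cross u (u + v) = cross u v" "cross v (u + v) = - cross u v"
    by (simp_all only: vec3_eq_iff cross_nth vector_uminus_component vector_add_component)
       (simp_all add: algebra_simps)
  then have nz: "cross u (u + v) \<noteq> 0" "cross v (u + v) \<noteq> 0" using uv by simp_all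
  then have "u + v \<noteq> 0" "u \<noteq> 0" "v \<noteq> 0"
    using uv by (metis cross_zero)+
  then show thesis using that[of u v "u + v"] uv nz by simp
qed

lemma PG2_line_three_points:
  assumes "L \<in> Lines PG2"
  shows "\<exists>A\<subseteq>L. card A = 3"
proof -
  obtain c where c: "c \<noteq> 0" "L = pg_line c" using assms by (auto simp: Lines_PG2)
  obtain u v w where uvw: "u \<noteq> 0" "v \<noteq> 0" "w \<noteq> 0" "dot3 c u = 0" "dot3 c v = 0" "dot3 c w = 0"
    "cross u v \<noteq> 0" "cross u w \<noteq> 0" "cross v w \<noteq> 0"
    using orthogonal_three[OF c(1)] by metis
  have "card {vec.span {u}, vec.span {v}, vec.span {w}} = 3"
    using uvw by (simp add: span_eq_iff_cross)
  moreover have "{vec.span {u}, vec.span {v}, vec.span {w}} \<subseteq> L"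
    using uvw c by (simp add: span_in_pg_line_iff)
  ultimately show ?thesis by blast
qed

lemma PG2_point_three_lines:
  assumes "p \<in> Points PG2"
  shows "\<exists>A\<subseteq>{L \<in> Lines PG2. p \<in> L}. card A = 3"
proof -
  obtain c where c: "c \<noteq> 0" "p = vec.span {c}" using assms by (auto simp: Points_PG2)
  obtain u v w where uvw: "u \<noteq> 0" "v \<noteq> 0" "w \<noteq> 0" "dot3 c u = 0" "dot3 c v = 0" "dot3 c w = 0"
    "cross u v \<noteq> 0" "cross u w \<noteq> 0" "cross v w \<noteq> 0"
    using orthogonal_three[OF c(1)] by metis
  have "card {pg_line u, pg_line v, pg_line w} = 3"
    using uvw by (simp add: pg_line_eq_iff_cross)
  moreover have "{pg_line u, pg_line v, pg_line w} \<subseteq> {L \<in> Lines PG2. p \<in> L}"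
    using uvw c by (auto simp: span_in_pg_line_iff dot3_commute Lines_PG2)
  ultimately show ?thesis by blast
qed

section \<open>Transfer of cardinalities along an isomorphism\<close>

lemma isomorphic_point_three_lines:
  assumes iso: "isomorphic_incidence R S"
    and S: "\<And>p. p \<in> Points S \<Longrightarrow> \<exists>A\<subseteq>{l \<in> Lines S. Inc S p l}. card A = 3"
    and p: "p \<in> Points R"
  shows "\<exists>A\<subseteq>{l \<in> Lines R. Inc R p l}. card A = 3"
proof -
  obtain f g where f: "bij_betw f (Points R) (Points S)" and g: "bij_betw g (Lines R) (Lines S)"
    and inc: "\<And>p l. p \<in> Points R \<Longrightarrow> l \<in> Lines R \<Longrightarrow> Inc R p l \<longleftrightarrow> Inc S (f p) (g l)"
    using iso unfolding isomorphic_incidence_def by blast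
  have "f p \<in> Points S" using f p bij_betwE by blast
  then obtain A where A: "A \<subseteq> {l \<in> Lines S. Inc S (f p) l}" "card A = 3" using S by blast
  let ?h = "inv_into (Lines R) g"
  have h: "?h l \<in> Lines R" "g (?h l) = l" if "l \<in> Lines S" for l
    using g that by (auto simp: bij_betw_def inv_into_into f_inv_into_f)
  have "card (?h ` A) = 3"
    using A h by (subst card_image) (auto intro!: inj_onI, metis subset_iff mem_Collect_eq)
  moreover have "?h ` A \<subseteq> {l \<in> Lines R. Inc R p l}"
    using A h inc p by fastforce
  ultimately show ?thesis by blast
qed

text \<open>By duality: an isomorphism stays one when points and lines are exchanged on both
  sides.\<close>

lemma isomorphic_line_three_points:
  assumes iso: "isomorphic_incidence R S"
    and S: "\<And>l. l \<in> Lines S \<Longrightarrow> \<exists>A\<subseteq>{p \<in> Points S. Inc S p l}. card A = 3"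
    and l: "l \<in> Lines R"
  shows "\<exists>A\<subseteq>{p \<in> Points R. Inc R p l}. card A = 3"
proof -
  let ?R = "\<lparr>Points = Lines R, Lines = Points R, Inc = (\<lambda>l p. Inc R p l)\<rparr>"
  let ?S = "\<lparr>Points = Lines S, Lines = Points S, Inc = (\<lambda>l p. Inc S p l)\<rparr>"
  have "isomorphic_incidence ?R ?S"
    using iso unfolding isomorphic_incidence_def by simp blast
  from isomorphic_point_three_lines[OF this, of l] S l show ?thesis by simp
qed

section \<open>Points and lines of the rectangle of a subplane\<close>

locale PG2_subplane =
  fixes \<pi> :: "(('a::field ^ 3) set, ('a ^ 3) set set) incidence_structure"
    and D :: "('a ^ 3) set"
  assumes subplane: "subplane \<pi> PG2"
    and D_point: "D \<in> Points \<pi>"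
    and three_lines: "p \<in> Points \<pi> \<Longrightarrow> \<exists>A\<subseteq>{L \<in> Lines \<pi>. Inc \<pi> p L}. card A = 3"
    and three_points: "L \<in> Lines \<pi> \<Longrightarrow> \<exists>A\<subseteq>{p \<in> Points \<pi>. Inc \<pi> p L}. card A = 3"
begin

abbreviation special :: "('a ^ 3) set set set" where
  "special \<equiv> rect_special_lines PG2 \<pi> D"

abbreviation rect_points :: "('a ^ 3) set set" where
  "rect_points \<equiv> \<Union>special"

abbreviation rect :: "(('a ^ 3) set, ('a ^ 3) set set) incidence_structure" where
  "rect \<equiv> subplane_rectangle PG2 \<pi> D"

lemma sub_points: "p \<in> Points \<pi> \<Longrightarrow> p \<in> Points PG2"
  and sub_lines: "L \<in> Lines \<pi> \<Longrightarrow> L \<in> Lines PG2"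
  and sub_inc: "p \<in> Points \<pi> \<Longrightarrow> L \<in> Lines \<pi> \<Longrightarrow> Inc \<pi> p L \<longleftrightarrow> p \<in> L"
  using subplane by (auto simp: subplane_def)

lemma sub_join:
  assumes "p \<in> Points \<pi>" "p' \<in> Points \<pi>" "p \<noteq> p'"
  obtains L where "L \<in> Lines \<pi>" "p \<in> L" "p' \<in> L"
proof -
  have "\<exists>!l. l \<in> Lines \<pi> \<and> Inc \<pi> p l \<and> Inc \<pi> p' l"
    using subplane assms by (simp add: subplane_def projective_plane_def has_unique_joins_def)
  then show thesis using that assms sub_inc by blast
qed

lemma sub_meet:
  assumes "L \<in> Lines \<pi>" "M \<in> Lines \<pi>" "L \<noteq> M"
  obtains p where "p \<in> Points \<pi>" "p \<in> L" "p \<in> M"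
proof -
  have "\<exists>!p. p \<in> Points \<pi> \<and> Inc \<pi> p L \<and> Inc \<pi> p M"
    using subplane assms by (simp add: subplane_def projective_plane_def)
  then show thesis using that assms sub_inc by blast
qed

text \<open>A special line shares two points with the subplane, so by uniqueness of joins in the big
  plane it is their join in the subplane. Conversely, a subplane line through \<open>D\<close> has a
  subplane point besides \<open>D\<close>, because it has three.\<close>

lemma special_eq: "special = {L \<in> Lines \<pi>. D \<in> L}"
proof (intro set_eqI iffI)
  fix L assume "L \<in> special"
  then obtain p where p: "L \<in> Lines PG2" "p \<in> Points \<pi>" "p \<noteq> D" "D \<in> L" "p \<in> L"
    by (auto simp: rect_special_lines_def)
  obtain M where "M \<in> Lines \<pi>" "D \<in> M" "p \<in> M"
    using sub_join[OF D_point p(2)] p(3) by metis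
  moreover from this have "L = M" using p PG2_join_unique sub_lines by metis
  ultimately show "L \<in> {L \<in> Lines \<pi>. D \<in> L}" by blast
next
  fix L assume L: "L \<in> {L \<in> Lines \<pi>. D \<in> L}"
  then obtain A where A: "A \<subseteq> {p \<in> Points \<pi>. Inc \<pi> p L}" "card A = 3"
    using three_points by blast
  have "\<not> A \<subseteq> {D}"
  proof
    assume "A \<subseteq> {D}"
    then have "card A \<le> card {D}" by (intro card_mono) auto
    with A show False by simp
  qed
  then obtain p where p: "p \<in> A" "p \<noteq> D" by blast
  then have "p \<in> Points \<pi>" "p \<in> L" using A L sub_inc by blast+
  then show "L \<in> special"
    using p L sub_lines unfolding rect_special_lines_def by blast
qed

lemma specialD:
  assumes "s \<in> special"
  shows "s \<in> Lines \<pi>" "s \<in> Lines PG2" "D \<in> s" "s \<subseteq> rect_points"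
  using assms sub_lines by (auto simp: special_eq)

lemma special_second_point:
  assumes "s \<in> special"
  obtains p where "p \<in> Points \<pi>" "p \<in> s" "p \<noteq> D"
  using assms by (auto simp: rect_special_lines_def)

lemma special_three: "\<exists>A\<subseteq>special. card A = 3"
proof -
  have "{L \<in> Lines \<pi>. Inc \<pi> D L} = special"
    using D_point sub_inc by (auto simp: special_eq)
  then show ?thesis using three_lines[OF D_point] by simp
qed

lemma special_unique:
  assumes "s \<in> special" "L \<in> Lines PG2" "D \<in> L" "p \<in> s" "p \<in> L" "p \<noteq> D"
  shows "L = s"
  using assms PG2_join_unique specialD by metis

lemma D_rect_point: "D \<in> rect_points"
proof -
  obtain A where "A \<subseteq> special" "card A = 3" using special_three by blast
  then have "special \<noteq> {}" by auto
  then show ?thesis using specialD by blast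
qed

lemma sub_points_rect: "Points \<pi> \<subseteq> rect_points"
proof
  fix p assume p: "p \<in> Points \<pi>"
  show "p \<in> rect_points"
  proof (cases "p = D")
    case False
    then obtain L where "L \<in> Lines \<pi>" "p \<in> L" "D \<in> L" using sub_join p D_point by metis
    then show ?thesis by (auto simp: special_eq)
  qed (use D_rect_point in simp)
qed

lemma rect_points_PG2: "rect_points \<subseteq> Points PG2"
  using PG2_line_subset specialD by blast

text \<open>Special lines lie entirely inside the point set, so they are restrictions too, and both
  kinds of lines can be handled uniformly.\<close>

lemma rect_lines_eq:
  "Lines rect = {L \<inter> rect_points | L. L \<in> Lines PG2 \<and> (D \<in> L \<longrightarrow> L \<in> special)}"
proof -
  have "s = s \<inter> rect_points" if "s \<in> special" for s using specialD that by blast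
  then have "special = {L \<inter> rect_points | L. L \<in> special}" by auto
  moreover have "{L \<inter> rect_points | L. L \<in> Lines PG2 \<and> (D \<in> L \<longrightarrow> L \<in> special)}
     = {L \<inter> rect_points | L. L \<in> special} \<union> rect_ordinary_lines PG2 \<pi> D"
    using specialD unfolding rect_ordinary_lines_def by blast
  ultimately show ?thesis by (simp add: subplane_rectangle_def)
qed

lemma rect_lineE:
  assumes "l \<in> Lines rect"
  obtains L where "L \<in> Lines PG2" "D \<in> L \<Longrightarrow> L \<in> special" "l = L \<inter> rect_points"
  using assms unfolding rect_lines_eq by blast

lemma rect_simps [simp]: "Points rect = rect_points" "Inc rect = (\<in>)"
  by (simp_all add: subplane_rectangle_def)

lemma rect_unique_joins: "has_unique_joins rect"
  unfolding has_unique_joins_def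
proof (intro ballI impI)
  fix p p' assume "p \<in> Points rect" "p' \<in> Points rect" and ne: "p \<noteq> p'"
  then have P: "p \<in> rect_points" "p' \<in> rect_points" by simp_all
  then obtain L where L: "L \<in> Lines PG2" "p \<in> L" "p' \<in> L"
    using PG2_join ne rect_points_PG2 by blast
  \<comment> \<open>One of the two points differs from \<open>D\<close>, and it lies on a special
    line, which must then be \<open>L\<close>.\<close>
  have "L \<in> special" if "D \<in> L"
  proof -
    obtain r where "r \<in> {p, p'}" "r \<noteq> D" using ne by blast
    then show ?thesis using special_unique L P that by blast
  qed
  then have "L \<inter> rect_points \<in> Lines rect" using L rect_lines_eq by blast
  moreover have "l = L \<inter> rect_points" if "l \<in> Lines rect" "p \<in> l" "p' \<in> l" for l
  proof -
    obtain M where "M \<in> Lines PG2" "l = M \<inter> rect_points" using \<open>l \<in> Lines rect\<close> rect_lineE by blast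
    then show ?thesis using PG2_join_unique[of M L p p'] L that ne by blast
  qed
  ultimately have "\<exists>!l. l \<in> Lines rect \<and> p \<in> l \<and> p' \<in> l"
    using L P by (intro ex1I[of _ "L \<inter> rect_points"]) blast+
  then show "\<exists>!l. l \<in> Lines rect \<and> Inc rect p l \<and> Inc rect p' l" by simp
qed

text \<open>A quadrangle of the subplane serves: a line of the rectangle through three of its points
  extends to a line with two subplane points, hence to a subplane line, and the three points would
  be collinear in the subplane.\<close>

lemma rect_quadrangle: "has_quadrangle rect"
proof -
  have "has_quadrangle \<pi>"
    using subplane by (simp add: subplane_def projective_plane_def)
  then obtain Q where Q: "Q \<subseteq> Points \<pi>" "card Q = 4"
    "\<And>T. T \<subseteq> Q \<Longrightarrow> card T = 3 \<Longrightarrow> \<not> collinear_in \<pi> T"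
    unfolding has_quadrangle_def by blast
  have "\<not> collinear_in rect T" if T: "T \<subseteq> Q" "card T = 3" for T
  proof
    assume "collinear_in rect T"
    then obtain l where l: "l \<in> Lines rect" "T \<subseteq> l"
      unfolding collinear_in_def rect_simps by blast
    obtain L where "L \<in> Lines PG2" "l = L \<inter> rect_points"
      using rect_lineE[OF l(1)] by blast
    with l(2) have L: "L \<in> Lines PG2" "T \<subseteq> L" by simp_all
    obtain x y z where "T = {x, y, z}" and xy_neq: "x \<noteq> y"
      using T(2) unfolding card_3_iff by metis
    then have xy: "x \<in> T" "y \<in> T" "x \<noteq> y" by simp_all
    then have xy_sub: "x \<in> Points \<pi>" "y \<in> Points \<pi>" using T Q by blast+
    then obtain M where M: "M \<in> Lines \<pi>" "x \<in> M" "y \<in> M" using sub_join xy(3) by metis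
    have "L = M" using PG2_join_unique[of L M x y] L xy M sub_lines[OF M(1)] by blast
    then have "\<forall>p\<in>T. Inc \<pi> p M" using L(2) T(1) Q(1) M(1) sub_inc by blast
    then show False using Q(3)[OF T] M(1) unfolding collinear_in_def by blast
  qed
  moreover have "Q \<subseteq> Points rect" using Q(1) sub_points_rect by simp
  ultimately show ?thesis using Q(2) unfolding has_quadrangle_def by blast
qed

lemma special_meets_line:
  assumes "s \<in> special" "L \<in> Lines PG2" "L \<noteq> s"
  shows "\<exists>!p. p \<in> rect_points \<and> p \<in> s \<and> p \<in> L"
proof -
  obtain p where "p \<in> s" "p \<in> L" using PG2_meet assms specialD by metis
  moreover have "p' = p" if "p' \<in> s" "p' \<in> L" for p'
    using PG2_join_unique[of s L p p'] calculation that assms specialD by blast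
  ultimately show ?thesis using assms specialD(4) by blast
qed

text \<open>A special line keeps all its points. An ordinary line meets three special lines, and the
  three points differ because special lines have only \<open>D\<close> in common.\<close>

lemma rect_line_three_points:
  assumes "l \<in> Lines rect"
  shows "\<exists>A\<subseteq>rect_points. card A = 3 \<and> (\<forall>p\<in>A. p \<in> l)"
proof -
  obtain L where L: "L \<in> Lines PG2" "D \<in> L \<Longrightarrow> L \<in> special" "l = L \<inter> rect_points"
    using assms rect_lineE by blast
  show ?thesis
  proof (cases "D \<in> L")
    case True
    then have "l = L" using L specialD by blast
    then show ?thesis using PG2_line_three_points[OF L(1)] L(3) by blast
  next
    case False
    obtain A where A: "A \<subseteq> special" "card A = 3" using special_three by blast
    have "\<exists>p. p \<in> rect_points \<and> p \<in> s \<and> p \<in> L" if "s \<in> special" for s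
      using special_meets_line[OF that L(1)] specialD[OF that] False by blast
    then obtain f where f: "\<And>s. s \<in> special \<Longrightarrow> f s \<in> rect_points \<and> f s \<in> s \<and> f s \<in> L"
      by metis
    have "inj_on f A"
    proof (rule inj_onI)
      fix s t assume st: "s \<in> A" "t \<in> A" "f s = f t"
      then have "s \<in> special" "t \<in> special" using A by blast+
      then show "s = t"
        using special_unique[of t s "f s"] st f specialD False by metis
    qed
    then have "card (f ` A) = 3" using A by (simp add: card_image)
    moreover have "f ` A \<subseteq> l" using f A(1) unfolding L(3) by blast
    ultimately show ?thesis using L(3) by (intro exI[of _ "f ` A"]) blast
  qed
qed

section \<open>Normalised functionals and homothetic quadrilaterals\<close>

lemma normalised_line:
  assumes "D = vec.span {d}" "d \<noteq> 0" "L \<in> Lines PG2" "D \<notin> L"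
  obtains a where "L = pg_line a" "dot3 a d = 1"
proof -
  obtain c where c: "L = pg_line c" using assms(3) by (auto simp: Lines_PG2)
  then have nz: "dot3 c d \<noteq> 0" using assms span_in_pg_line_iff by metis
  have "pg_line ((1 / dot3 c d) *s c) = L" using nz c by (simp add: pg_line_scale)
  then show thesis using that[of "(1 / dot3 c d) *s c"] nz by simp
qed

text \<open>The functional \<open>a - b\<close> vanishes at \<open>d\<close>, where both take the
  value 1, and at the common point \<open>p\<close>, so it is a coordinate vector of the join of
  \<open>D\<close> and \<open>p\<close>.\<close>

lemma pencil_line_eq:
  assumes d: "D = vec.span {d}" "d \<noteq> 0"
    and ab: "dot3 a d = 1" "dot3 b d = 1" "a \<noteq> b"
    and p: "p \<in> pg_line a" "p \<in> pg_line b" "p \<in> s"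
    and s: "s \<in> Lines PG2" "D \<in> s"
  shows "s = pg_line (a - b)"
proof -
  obtain x where x: "x \<noteq> 0" "p = vec.span {x}" using p(1) by (auto simp: pg_line_def)
  have "D \<notin> pg_line a" using d ab by (simp add: span_in_pg_line_iff)
  then have "p \<noteq> D" using p by blast
  moreover have "p \<in> pg_line (a - b)" "D \<in> pg_line (a - b)"
    using p x d ab by (simp_all add: span_in_pg_line_iff)
  moreover have "pg_line (a - b) \<in> Lines PG2" using ab by (auto simp: Lines_PG2)
  ultimately show ?thesis using PG2_join_unique s p by metis
qed

text \<open>
  The triangle \<open>a1'\<close>, \<open>a2'\<close>, \<open>b'\<close> of functionals has sides parallel to those of \<open>a1\<close>, \<open>a2\<close>, \<open>b\<close>,
  hence is a homothetic copy of it.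
\<close>

lemma homothetic_line:
  assumes d: "D = vec.span {d}" "d \<noteq> 0"
    and a: "dot3 a1 d = 1" "dot3 a2 d = 1"
    and b: "dot3 b d = 1" "a1 \<noteq> b" "a2 \<noteq> b"
    and a': "dot3 a1' d = 1" "dot3 a2' d = 1" "pg_line a1' \<in> Lines \<pi>" "pg_line a2' \<in> Lines \<pi>"
    and hom: "a1' - a2' = k *s (a1 - a2)"
    and s: "pg_line (a1 - b) \<in> special" "pg_line (a2 - b) \<in> special"
      "pg_line (a1 - b) \<noteq> pg_line (a2 - b)"
  obtains b' where "dot3 b' d = 1" "pg_line b' \<in> Lines \<pi>" "a1' - b' = k *s (a1 - b)"
proof -
  have D: "D \<notin> pg_line a1'" "D \<notin> pg_line a2'"
    using d a' by (simp_all add: span_in_pg_line_iff)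
  have neq: "pg_line a1' \<noteq> pg_line (a1 - b)" "pg_line a2' \<noteq> pg_line (a2 - b)"
    using D s specialD by blast+
  \<comment> \<open>The new side is the join of the subplane points where \<open>pg_line a1'\<close>
    and \<open>pg_line a2'\<close> meet the two prescribed special lines.\<close>
  obtain p1 where p1: "p1 \<in> Points \<pi>" "p1 \<in> pg_line a1'" "p1 \<in> pg_line (a1 - b)"
    using sub_meet[OF a'(3) specialD(1)[OF s(1)] neq(1)] by blast
  obtain p2 where p2: "p2 \<in> Points \<pi>" "p2 \<in> pg_line a2'" "p2 \<in> pg_line (a2 - b)"
    using sub_meet[OF a'(4) specialD(1)[OF s(2)] neq(2)] by blast
  have pD: "p1 \<noteq> D" "p2 \<noteq> D" using p1 p2 D by blast+
  have "p1 \<noteq> p2"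
    using special_unique[OF s(2) specialD(2,3)[OF s(1)]] p1 p2 pD s(3) by blast
  then obtain M where M: "M \<in> Lines \<pi>" "p1 \<in> M" "p2 \<in> M"
    using sub_join p1 p2 by metis
  have "D \<notin> M"
    using special_unique[OF s(1) sub_lines[OF M(1)]] special_unique[OF s(2) sub_lines[OF M(1)]]
      M p1 p2 pD s(3) by metis
  then obtain b' where b': "M = pg_line b'" "dot3 b' d = 1"
    using normalised_line d sub_lines[OF M(1)] by metis
  \<comment> \<open>Both differences vanish at \<open>p\<close> and at \<open>d\<close>, hence are
    proportional: corresponding sides are parallel.\<close>
  have side: "\<exists>l. a' - b' = l *s (a - b)"
    if h: "p \<noteq> D" "p \<in> pg_line a'" "p \<in> pg_line (a - b)" "p \<in> M"
      "dot3 a' d = 1" "dot3 a d = 1" "a \<noteq> b" for p a a'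
  proof -
    obtain x where x: "x \<noteq> 0" "p = vec.span {x}" using h(2) by (auto simp: pg_line_def)
    have "cross x d \<noteq> 0" using x d h span_eq_iff_cross by metis
    then show ?thesis
      by (rule common_orthogonal_scale) (use h x b b' in \<open>simp_all add: span_in_pg_line_iff\<close>)
  qed
  obtain l where l: "a1' - b' = l *s (a1 - b)"
    using side[of p1 a1' a1] pD p1 M a' a b by blast
  obtain m where m: "a2' - b' = m *s (a2 - b)"
    using side[of p2 a2' a2] pD p2 M a' a b by blast
  have ind: "cross (a1 - b) (a2 - b) \<noteq> 0"
    using s(3) b pg_line_eq_iff_cross[of "a1 - b" "a2 - b"] by auto
  \<comment> \<open>Comparing coefficients of the independent vectors \<open>a1 - b\<close> and
    \<open>a2 - b\<close> forces the ratios \<open>l\<close> and \<open>m\<close> to equal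
    \<open>k\<close>.\<close>
  have "k *s (a1 - a2) = l *s (a1 - b) - m *s (a2 - b)"
    using hom l m by (metis diff_diff_eq2 diff_add_cancel)
  then have eq: "(k - l) *s (a1 - b) = (k - m) *s (a2 - b)"
    by (simp add: vec3_eq_iff algebra_simps)
  have "(k - m) *s cross (a1 - b) (a2 - b) = cross (a1 - b) ((k - l) *s (a1 - b))"
    by (simp only: eq cross_scale_right)
  also have "\<dots> = 0" by (simp only: cross_scale_right cross_self vec.scale_zero_right)
  finally have "k - m = 0" using ind vec.scale_eq_0_iff by blast
  then have "(k - l) *s (a1 - b) = 0" using eq by simp
  then have "k = l" using b by (metis vec.scale_eq_0_iff right_minus_eq)
  then show thesis using that[of b'] b' M l by blast
qed

text \<open>This is the core case of (A6): a quadrilateral of four distinct ordinary lines with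
  sides \<open>L1\<close>, \<open>L2\<close>, \<open>M1\<close>, \<open>M2\<close>. Five of its
  vertices are in the rectangle, and the sixth is the intersection of \<open>M1\<close> and
  \<open>M2\<close>.\<close>

lemma sixth_vertex_in_rect:
  assumes lines: "L1 \<in> Lines PG2" "L2 \<in> Lines PG2" "M1 \<in> Lines PG2" "M2 \<in> Lines PG2"
    and D: "D \<notin> L1" "D \<notin> L2" "D \<notin> M1" "D \<notin> M2"
    and neq: "L1 \<noteq> L2" "M1 \<noteq> M2" "L1 \<noteq> M1" "L2 \<noteq> M1" "L1 \<noteq> M2" "L2 \<noteq> M2"
    and p: "p \<in> rect_points" "p \<in> L1" "p \<in> L2"
    and p11: "p11 \<in> rect_points" "p11 \<in> M1" "p11 \<in> L1"
    and p12: "p12 \<in> rect_points" "p12 \<in> M1" "p12 \<in> L2"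
    and p21: "p21 \<in> rect_points" "p21 \<in> M2" "p21 \<in> L1"
    and p22: "p22 \<in> rect_points" "p22 \<in> M2" "p22 \<in> L2"
    and pneq: "p11 \<noteq> p12" "p21 \<noteq> p22"
  shows "\<exists>r\<in>rect_points. r \<in> M1 \<and> r \<in> M2"
proof -
  obtain d where d: "D = vec.span {d}" "d \<noteq> 0"
    using sub_points[OF D_point] by (auto simp: Points_PG2)
  obtain a1 where a1: "L1 = pg_line a1" "dot3 a1 d = 1"
    using normalised_line[OF d lines(1) D(1)] .
  obtain a2 where a2: "L2 = pg_line a2" "dot3 a2 d = 1"
    using normalised_line[OF d lines(2) D(2)] .
  obtain b1 where b1: "M1 = pg_line b1" "dot3 b1 d = 1"
    using normalised_line[OF d lines(3) D(3)] .
  obtain b2 where b2: "M2 = pg_line b2" "dot3 b2 d = 1"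
    using normalised_line[OF d lines(4) D(4)] .
  have vneq: "a1 \<noteq> a2" "b1 \<noteq> b2" "a1 \<noteq> b1" "a2 \<noteq> b1" "a1 \<noteq> b2" "a2 \<noteq> b2"
    using neq a1 a2 b1 b2 by blast+
  have special: "pg_line (a - b) \<in> special \<and> x \<in> pg_line (a - b)"
    if h: "x \<in> rect_points" "x \<in> pg_line a" "x \<in> pg_line b" "dot3 a d = 1" "dot3 b d = 1" "a \<noteq> b"
    for a b x
  proof -
    obtain s where "s \<in> special" "x \<in> s" using h by blast
    moreover from this have "s = pg_line (a - b)"
      using pencil_line_eq[OF d h(4-6,2,3)] specialD by blast
    ultimately show ?thesis by blast
  qed
  have sp: "pg_line (a1 - a2) \<in> special" using special p a1 a2 vneq by blast
  have s11: "pg_line (a1 - b1) \<in> special" "p11 \<in> pg_line (a1 - b1)"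
    using special p11 a1 b1 vneq by blast+
  have s12: "pg_line (a2 - b1) \<in> special" "p12 \<in> pg_line (a2 - b1)"
    using special p12 a2 b1 vneq by blast+
  have s21: "pg_line (a1 - b2) \<in> special" "p21 \<in> pg_line (a1 - b2)"
    using special p21 a1 b2 vneq by blast+
  have s22: "pg_line (a2 - b2) \<in> special" "p22 \<in> pg_line (a2 - b2)"
    using special p22 a2 b2 vneq by blast+
  \<comment> \<open>A special line through both \<open>p11\<close> and \<open>p12\<close> would be
    \<open>M1\<close>, which misses \<open>D\<close>.\<close>
  have sneq1: "pg_line (a1 - b1) \<noteq> pg_line (a2 - b1)"
    using PG2_join_unique[OF lines(3) specialD(2)[OF s11(1)] p11(2) p12(2)] pneq s11 s12 D
      specialD(3)[OF s11(1)] by metis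
  have sneq2: "pg_line (a1 - b2) \<noteq> pg_line (a2 - b2)"
    using PG2_join_unique[OF lines(4) specialD(2)[OF s21(1)] p21(2) p22(2)] pneq s21 s22 D
      specialD(3)[OF s21(1)] by metis
  obtain p' where p': "p' \<in> Points \<pi>" "p' \<in> pg_line (a1 - a2)" "p' \<noteq> D"
    using special_second_point[OF sp] .
  \<comment> \<open>The copy in the subplane starts at \<open>p'\<close>: of three subplane lines
    through it, at least two differ from the special line of \<open>a1 - a2\<close>. They play the
    roles of \<open>L1\<close> and \<open>L2\<close>.\<close>
  obtain L1' L2' where L': "L1' \<in> Lines \<pi>" "L2' \<in> Lines \<pi>" "p' \<in> L1'" "p' \<in> L2'" "L1' \<noteq> L2'"
    "L1' \<noteq> pg_line (a1 - a2)" "L2' \<noteq> pg_line (a1 - a2)"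
  proof -
    obtain A where A: "A \<subseteq> {L \<in> Lines \<pi>. Inc \<pi> p' L}" "card A = 3"
      using three_lines[OF p'(1)] by blast
    then have A': "A \<subseteq> {L \<in> Lines \<pi>. p' \<in> L}" using sub_inc p' by blast
    obtain x y z where xyz: "A = {x, y, z}" "x \<noteq> y" "x \<noteq> z" "y \<noteq> z"
      using A by (auto simp: card_3_iff)
    show thesis
    proof (cases "x = pg_line (a1 - a2)")
      case True
      then show thesis using that[of y z] A' xyz by auto
    next
      case False
      then show thesis using that[of x y] that[of x z] A' xyz by auto
    qed
  qed
  have D': "D \<notin> L1'" "D \<notin> L2'"
    using special_unique[OF sp] L' p' sub_lines by metis+
  obtain a1' where a1': "L1' = pg_line a1'" "dot3 a1' d = 1"
    using normalised_line[OF d sub_lines[OF L'(1)] D'(1)] .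
  obtain a2' where a2': "L2' = pg_line a2'" "dot3 a2' d = 1"
    using normalised_line[OF d sub_lines[OF L'(2)] D'(2)] .
  \<comment> \<open>The differences both vanish at \<open>p'\<close> and at \<open>d\<close>;
    \<open>k\<close> is the ratio of the homothety.\<close>
  obtain k where k: "a1' - a2' = k *s (a1 - a2)"
  proof -
    obtain x where x: "x \<noteq> 0" "p' = vec.span {x}" using p' by (auto simp: pg_line_def)
    have "cross x d \<noteq> 0" using x d p' span_eq_iff_cross by metis
    then have "\<exists>k. a1' - a2' = k *s (a1 - a2)"
      by (rule common_orthogonal_scale)
        (use L' p' a1' a2' a1 a2 x vneq in \<open>simp_all add: span_in_pg_line_iff\<close>)
    then show thesis using that by blast
  qed
  have "k \<noteq> 0" using k a1' a2' L' by auto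
  \<comment> \<open>The lines \<open>M1\<close> and \<open>M2\<close> are both copied starting from
    the same pair \<open>a1'\<close>, \<open>a2'\<close>, so the same ratio \<open>k\<close> governs
    both triangles.\<close>
  obtain b1' where b1': "dot3 b1' d = 1" "pg_line b1' \<in> Lines \<pi>" "a1' - b1' = k *s (a1 - b1)"
    using homothetic_line[OF d a1(2) a2(2) b1(2) vneq(3,4) a1'(2) a2'(2) _ _ k s11(1) s12(1) sneq1]
      L' a1' a2' by blast
  obtain b2' where b2': "dot3 b2' d = 1" "pg_line b2' \<in> Lines \<pi>" "a1' - b2' = k *s (a1 - b2)"
    using homothetic_line[OF d a1(2) a2(2) b2(2) vneq(5,6) a1'(2) a2'(2) _ _ k s21(1) s22(1) sneq2]
      L' a1' a2' by blast
  have "b1' - b2' = (a1' - b2') - (a1' - b1')" by simp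
  also have "\<dots> = k *s (b1 - b2)"
    unfolding b1' b2' by (simp add: vec3_eq_iff algebra_simps)
  finally have hom: "b1' - b2' = k *s (b1 - b2)" .
  then have b_neq: "b1' \<noteq> b2'" using \<open>k \<noteq> 0\<close> vneq by auto
  \<comment> \<open>Equal lines have proportional functionals, and the value 1 at \<open>d\<close>
    makes these equal.\<close>
  have "pg_line b1' \<noteq> pg_line b2'"
  proof
    assume eq: "pg_line b1' = pg_line b2'"
    have nz: "b1' \<noteq> 0" "b2' \<noteq> 0" using b1' b2' by auto
    then obtain c where c: "b2' = c *s b1'"
      using eq pg_line_eq_iff_cross cross_eq_0_imp_scale by metis
    then have "c = 1" using b1' b2' by simp
    then show False using c b_neq by simp
  qed
  then obtain r' where r': "r' \<in> Points \<pi>" "r' \<in> pg_line b1'" "r' \<in> pg_line b2'"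
    using sub_meet b1' b2' by metis
  \<comment> \<open>The copied sixth vertex \<open>r'\<close> is a subplane point, so its join with
    \<open>D\<close> is special; by homothety that join is also the line of
    \<open>b1 - b2\<close>.\<close>
  have "pg_line (b1' - b2') \<in> special"
    using special[of r' b1' b2'] r' sub_points_rect b1' b2' b_neq by blast
  then have sr: "pg_line (b1 - b2) \<in> special"
    using \<open>k \<noteq> 0\<close> by (metis hom pg_line_scale)
  obtain r where r: "r \<in> M1" "r \<in> M2" using PG2_meet lines neq by metis
  then obtain x where x: "x \<noteq> 0" "r = vec.span {x}" using b1 by (auto simp: pg_line_def)
  then have "r \<in> pg_line (b1 - b2)" using r b1 b2 by (simp add: span_in_pg_line_iff)
  then show ?thesis using sr r by blast
qed

section \<open>Axioms (A5) and (A6) for the rectangle\<close>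

lemma rect_special_meets:
  assumes "s \<in> Lines rect" "l \<in> Lines rect" "D \<in> s" "l \<noteq> s"
  shows "\<exists>!p. p \<in> rect_points \<and> p \<in> s \<and> p \<in> l"
proof -
  obtain S where S: "S \<in> Lines PG2" "D \<in> S \<Longrightarrow> S \<in> special" "s = S \<inter> rect_points"
    using rect_lineE[OF assms(1)] by blast
  then have sp: "S \<in> special" "s = S" using assms specialD by blast+
  obtain L where L: "L \<in> Lines PG2" "l = L \<inter> rect_points"
    using rect_lineE[OF assms(2)] by blast
  have "L \<noteq> S" using L S assms by blast
  then show ?thesis using special_meets_line[OF sp(1) L(1)] sp L by blast
qed

text \<open>If \<open>m1\<close> or \<open>m2\<close> is special, they meet by (A5). If one of them
  equals \<open>l1\<close> or \<open>l2\<close>, one of the four given points is already common to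
  both. Otherwise the extensions to the big plane form a quadrilateral of ordinary lines.\<close>

lemma rect_meet:
  assumes l: "l1 \<in> Lines rect" "l2 \<in> Lines rect" "D \<notin> l1" "D \<notin> l2" "l1 \<noteq> l2"
    and p: "p \<in> rect_points" "p \<in> l1" "p \<in> l2"
    and m: "m1 \<in> Lines rect" "m2 \<in> Lines rect" "m1 \<noteq> m2"
    and p11: "p11 \<in> m1" "p11 \<in> l1" and p12: "p12 \<in> m1" "p12 \<in> l2"
    and p21: "p21 \<in> m2" "p21 \<in> l1" and p22: "p22 \<in> m2" "p22 \<in> l2"
    and pneq: "p11 \<noteq> p12" "p21 \<noteq> p22"
  shows "\<exists>r\<in>rect_points. r \<in> m1 \<and> r \<in> m2"
proof -
  obtain L1 where L1: "L1 \<in> Lines PG2" "l1 = L1 \<inter> rect_points"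
    using rect_lineE[OF l(1)] by blast
  obtain L2 where L2: "L2 \<in> Lines PG2" "l2 = L2 \<inter> rect_points"
    using rect_lineE[OF l(2)] by blast
  obtain M1 where M1: "M1 \<in> Lines PG2" "m1 = M1 \<inter> rect_points"
    using rect_lineE[OF m(1)] by blast
  obtain M2 where M2: "M2 \<in> Lines PG2" "m2 = M2 \<inter> rect_points"
    using rect_lineE[OF m(2)] by blast
  consider "D \<in> m1" | "D \<in> m2" | "l1 = m1" | "l2 = m1" | "l1 = m2" | "l2 = m2"
    | "D \<notin> m1" "D \<notin> m2" "l1 \<noteq> m1" "l2 \<noteq> m1" "l1 \<noteq> m2" "l2 \<noteq> m2"
    by blast
  then show ?thesis
  proof cases
    case 1
    then show ?thesis using rect_special_meets m by metis
  next
    case 2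
    then show ?thesis using rect_special_meets m by metis
  next
    case 7
    have "D \<notin> L1" "D \<notin> L2" "D \<notin> M1" "D \<notin> M2"
      using 7 l(3,4) D_rect_point unfolding L1(2) L2(2) M1(2) M2(2) by blast+
    moreover have "L1 \<noteq> L2" "M1 \<noteq> M2" "L1 \<noteq> M1" "L2 \<noteq> M1" "L1 \<noteq> M2" "L2 \<noteq> M2"
      using 7 l(5) m(3) unfolding L1(2) L2(2) M1(2) M2(2) by blast+
    ultimately have "\<exists>r\<in>rect_points. r \<in> M1 \<and> r \<in> M2"
      using sixth_vertex_in_rect[OF L1(1) L2(1) M1(1) M2(1), of p p11 p12 p21 p22] pneq
        p p11 p12 p21 p22 unfolding L1(2) L2(2) M1(2) M2(2) Int_iff by satx
    then show ?thesis unfolding M1(2) M2(2) by blast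
  qed (use p11 p12 p21 p22 L1 L2 in blast)+
qed

theorem projective_rectangle_rect: "projective_rectangle rect D"
  unfolding projective_rectangle_def
proof (intro conjI ballI impI)
  fix l1 l2 m1 m2
  assume l: "l1 \<in> Lines rect" "l2 \<in> Lines rect"
    and l': "\<not> Inc rect D l1 \<and> \<not> Inc rect D l2 \<and> l1 \<noteq> l2 \<and> meet_in_point rect l1 l2"
    and m: "m1 \<in> Lines rect" "m2 \<in> Lines rect"
    and m': "m1 \<noteq> m2 \<and>
           (\<exists>p11\<in>Points rect. \<exists>p12\<in>Points rect. \<exists>p21\<in>Points rect. \<exists>p22\<in>Points rect.
              distinct [p11, p12, p21, p22] \<and>
              Inc rect p11 m1 \<and> Inc rect p11 l1 \<and> Inc rect p12 m1 \<and> Inc rect p12 l2 \<and>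
              Inc rect p21 m2 \<and> Inc rect p21 l1 \<and> Inc rect p22 m2 \<and> Inc rect p22 l2)"
  obtain p where p: "p \<in> rect_points" "p \<in> l1" "p \<in> l2"
    using l' by (auto simp: meet_in_point_def)
  obtain p11 p12 p21 p22 where dist: "distinct [p11, p12, p21, p22]"
    and p': "p11 \<in> m1" "p11 \<in> l1" "p12 \<in> m1" "p12 \<in> l2"
      "p21 \<in> m2" "p21 \<in> l1" "p22 \<in> m2" "p22 \<in> l2"
    using m' unfolding rect_simps by blast
  have "p11 \<noteq> p12" "p21 \<noteq> p22" using dist by simp_all
  then have "\<exists>r\<in>rect_points. r \<in> m1 \<and> r \<in> m2"
    using rect_meet[OF l _ _ _ p m _ p'] l' m' unfolding rect_simps by blast
  then show "meet_in_point rect m1 m2" by (simp add: meet_in_point_def)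
qed (use rect_unique_joins rect_quadrangle rect_line_three_points D_rect_point
      rect_special_meets in \<open>simp_all only: rect_simps simp_thms\<close>)

end

theorem theorem4p7:
  fixes q k :: nat
    and Pl :: "(('a::{field, finite} ^ 3) set, ('a ^ 3) set set) incidence_structure"
    and \<pi> :: "(('a ^ 3) set, ('a ^ 3) set set) incidence_structure"
    and D :: "('a ^ 3) set"
  assumes "primepow q"
    and "k > 1"
    and "CARD('a) = q ^ k"
    and "Pl = PG2"
    and "CARD('b::{field, finite}) = q"
    and "subplane \<pi> Pl"
    and "isomorphic_incidence \<pi> (PG2 :: (('b ^ 3) set, ('b ^ 3) set set) incidence_structure)"
    and "D \<in> Points \<pi>"
  shows "projective_rectangle (subplane_rectangle Pl \<pi> D) D"
proof -
  \<comment> \<open>The isomorphism with the plane over the field with \<open>q\<close> elements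
    supplies three lines through each subplane point and three points on each subplane line.\<close>
  interpret PG2_subplane \<pi> D
  proof
    fix p assume "p \<in> Points \<pi>"
    then show "\<exists>A\<subseteq>{L \<in> Lines \<pi>. Inc \<pi> p L}. card A = 3"
      by (rule isomorphic_point_three_lines[OF assms(7), rotated])
        (simp add: PG2_point_three_lines)
  next
    fix L assume L: "L \<in> Lines \<pi>"
    have "\<exists>A\<subseteq>{p \<in> Points PG2. Inc PG2 p l}. card A = 3" if "l \<in> Lines PG2"
      for l :: "('b ^ 3) set set"
      using PG2_line_three_points[OF that] PG2_line_subset[OF that] by auto
    then show "\<exists>A\<subseteq>{p \<in> Points \<pi>. Inc \<pi> p L}. card A = 3"
      using isomorphic_line_three_points[OF assms(7) _ L] by blast
  qed (use assms in auto)
  show ?thesis using projective_rectangle_rect assms(4) by simp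
qed

end
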